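(* For any non-zero operator $-A$ generating a bounded analytic semigroup on a Hilbert space $\mathcal{H}$ and any $\beta\ge 1$, the operator $\mathcal{M}_{+}$ is not bounded on $L^2(0,\infty;t^\beta dt,\mathcal{H})$ and the operator $\mathcal{M}_{-}$ is not bounded on $L^2(0,\infty;t^{-\beta}dt,\mathcal{H})$. (That is, these operators, initially defined on $L^2_c(0,\infty;dt,\mathsf{D}(A))$, do not extend to bounded operators on the respective weighted spaces.)
   Context: $\mathcal{H}$ is a Hilbert space with norm $\|\cdot\|$. "$-A$ generates a bounded analytic semigroup on $\mathcal{H}$" means that $A$ is a densely defined closed linear operator on $\mathcal{H}$ and $-A$ generates a bounded analytic semigroup $\{e^{-zA}:|\arg z|<\delta\}$ for some $0<\delta<\pi/2$. $\mathsf{D}(A)$ is the domain of $A$ (a Hilbert space for the graph norm). For $\beta\in\mathbf{R}$, $L^2(0,\infty;t^\beta dt,\mathcal{H})$ is the space of (classes of) strongly measurable $f:(0,\infty)\to\mathcal{H}$ with $\int_0^\infty\|f(t)\|^2t^\beta\,dt<\infty$. $L^2_{c}(0,\infty;dt,\mathsf{D}(A))$ is the space of $f\in L^2(0,\infty;dt,\mathsf{D}(A))$ with compact support in $(0,\infty)$. For $f\in L^2_{c}(0,\infty;dt,\mathsf{D}(A))$ and $t>0$, $$\mathcal{M}_{+}f(t)=\int_{0}^t Ae^{-(t-s)A}f(s)\,ds,\qquad \mathcal{M}_{-}f(t)=\int_{t}^\infty Ae^{-(s-t)A}f(s)\,ds.$$ *)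

theory Defs
  imports "HOL-Analysis.Analysis"
begin

section \<open>Complex Hilbert spaces\<close>

text \<open>The topology and norm are those of the underlying real inner product space, whose inner
  product is the real part of the complex one.  Hence \<open>norm x = sqrt (Re (cinner x x))\<close>.\<close>

class complex_hilbert_space = real_inner + complete_space +
  fixes scaleC :: "complex \<Rightarrow> 'a \<Rightarrow> 'a"  (infixr "*\<^sub>C" 75)
    and cinner :: "'a \<Rightarrow> 'a \<Rightarrow> complex"
  assumes scaleC_add_right: "c *\<^sub>C (x + y) = c *\<^sub>C x + c *\<^sub>C y"
    and scaleC_add_left: "(b + c) *\<^sub>C x = b *\<^sub>C x + c *\<^sub>C x"
    and scaleC_scaleC: "b *\<^sub>C c *\<^sub>C x = (b * c) *\<^sub>C x"
    and scaleC_of_real: "complex_of_real r *\<^sub>C x = r *\<^sub>R x"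
    and cinner_commute: "cinner x y = cnj (cinner y x)"
    and cinner_add_left: "cinner (x + y) z = cinner x z + cinner y z"
    and cinner_scaleC_left: "cinner (c *\<^sub>C x) y = c * cinner x y"
    and Re_cinner: "Re (cinner x y) = inner x y"

instantiation complex :: complex_hilbert_space
begin

definition scaleC_complex :: "complex \<Rightarrow> complex \<Rightarrow> complex"
  where "scaleC_complex c x = c * x"

definition cinner_complex :: "complex \<Rightarrow> complex \<Rightarrow> complex"
  where "cinner_complex x y = x * cnj y"

instance
  by standard
    (auto simp: scaleC_complex_def cinner_complex_def algebra_simps scaleR_conv_of_real
      inner_complex_def)

end

section \<open>Unbounded operators and bounded analytic semigroups\<close>

text \<open>An operator is a pair of a domain \<open>D\<close> and a function \<open>A\<close>, whose values outside \<open>D\<close> are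
  irrelevant.\<close>

definition clinear_on :: "'a::complex_hilbert_space set \<Rightarrow> ('a \<Rightarrow> 'a) \<Rightarrow> bool" where
  "clinear_on D A \<longleftrightarrow>
     0 \<in> D \<and>
     (\<forall>x\<in>D. \<forall>y\<in>D. x + y \<in> D \<and> A (x + y) = A x + A y) \<and>
     (\<forall>c. \<forall>x\<in>D. c *\<^sub>C x \<in> D \<and> A (c *\<^sub>C x) = c *\<^sub>C A x)"

definition densely_defined_closed_operator :: "'a::complex_hilbert_space set \<Rightarrow> ('a \<Rightarrow> 'a) \<Rightarrow> bool"
  where "densely_defined_closed_operator D A \<longleftrightarrow>
     clinear_on D A \<and> closure D = UNIV \<and> closed {(x, A x) |x. x \<in> D}"

definition sector :: "real \<Rightarrow> complex set" where
  "sector \<delta> = {z. z \<noteq> 0 \<and> \<bar>Arg z\<bar> < \<delta>}"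

text \<open>Analyticity is required in the strong sense, which for locally bounded families of operators
  is equivalent to analyticity in operator norm.  As usual, boundedness and strong continuity
  at 0 are required on all strictly smaller sectors.\<close>

definition bounded_analytic_semigroup ::
  "real \<Rightarrow> (complex \<Rightarrow> 'a::complex_hilbert_space \<Rightarrow> 'a) \<Rightarrow> bool" where
  "bounded_analytic_semigroup \<delta> S \<longleftrightarrow>
     (\<forall>x. S 0 x = x) \<and>
     (\<forall>z\<in>sector \<delta>. clinear_on UNIV (S z)) \<and>
     (\<forall>z\<in>sector \<delta>. \<forall>w\<in>sector \<delta>. \<forall>x. S (z + w) x = S z (S w x)) \<and>
     (\<forall>x. \<forall>z\<in>sector \<delta>. \<exists>y. ((\<lambda>w. S w x) has_derivative (\<lambda>h. h *\<^sub>C y)) (at z)) \<and>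
     (\<forall>\<epsilon>. 0 < \<epsilon> \<and> \<epsilon> < \<delta> \<longrightarrow>
        (\<exists>M. \<forall>z\<in>sector \<epsilon>. \<forall>x. norm (S z x) \<le> M * norm x) \<and>
        (\<forall>x. ((\<lambda>z. S z x) \<longlongrightarrow> x) (at 0 within sector \<epsilon>)))"

text \<open>\<open>G\<close> with domain \<open>D\<close> is the infinitesimal generator of \<open>(S t)\<close>, \<open>t \<ge> 0\<close>.\<close>

definition infinitesimal_generator ::
  "'a::complex_hilbert_space set \<Rightarrow> ('a \<Rightarrow> 'a) \<Rightarrow> (complex \<Rightarrow> 'a \<Rightarrow> 'a) \<Rightarrow> bool" where
  "infinitesimal_generator D G S \<longleftrightarrow>
     D = {x. \<exists>y. ((\<lambda>t. (S (complex_of_real t) x - x) /\<^sub>R t) \<longlongrightarrow> y) (at_right 0)} \<and>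
     (\<forall>x\<in>D. ((\<lambda>t. (S (complex_of_real t) x - x) /\<^sub>R t) \<longlongrightarrow> G x) (at_right 0))"

text \<open>\<open>-A\<close> generates a bounded analytic semigroup, namely \<open>S z = exp (-zA)\<close>.\<close>

definition neg_generates_bounded_analytic_semigroup ::
  "'a::complex_hilbert_space set \<Rightarrow> ('a \<Rightarrow> 'a) \<Rightarrow> (complex \<Rightarrow> 'a \<Rightarrow> 'a) \<Rightarrow> bool" where
  "neg_generates_bounded_analytic_semigroup D A S \<longleftrightarrow>
     densely_defined_closed_operator D A \<and>
     (\<exists>\<delta>. 0 < \<delta> \<and> \<delta> < pi / 2 \<and> bounded_analytic_semigroup \<delta> S) \<and>
     infinitesimal_generator D (\<lambda>x. - A x) S"

section \<open>The function spaces\<close>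

text \<open>Functions with values in a subspace \<open>V\<close> that carries its own norm \<open>N\<close>.  Strong
  measurability means being an a.e. limit of simple functions; the space \<open>V\<close> need not be separable,
  so this is stronger than Borel measurability.  Classes modulo a.e. equality are represented by
  functions.\<close>

definition strongly_measurable ::
  "'b measure \<Rightarrow> 'a::real_vector set \<Rightarrow> ('a \<Rightarrow> real) \<Rightarrow> ('b \<Rightarrow> 'a) \<Rightarrow> bool" where
  "strongly_measurable M V N f \<longleftrightarrow>
     (\<exists>s :: nat \<Rightarrow> 'b \<Rightarrow> 'a.
        (\<forall>n. simple_function M (s n) \<and> s n ` space M \<subseteq> V) \<and>
        (AE t in M. f t \<in> V \<and> (\<lambda>n. N (s n t - f t)) \<longlonglongrightarrow> 0))"

definition L2_space ::
  "'b measure \<Rightarrow> 'a::real_vector set \<Rightarrow> ('a \<Rightarrow> real) \<Rightarrow> ('b \<Rightarrow> 'a) set" where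
  "L2_space M V N = {f. strongly_measurable M V N f \<and> integrable M (\<lambda>t. (N (f t))\<^sup>2)}"

definition weighted_half_line :: "real \<Rightarrow> real measure" where
  "weighted_half_line \<beta> = density (lebesgue_on {0<..}) (\<lambda>t. ennreal (t powr \<beta>))"

abbreviation L2_weighted :: "real \<Rightarrow> (real \<Rightarrow> 'a::complex_hilbert_space) set" where
  "L2_weighted \<beta> \<equiv> L2_space (weighted_half_line \<beta>) UNIV norm"

definition L2_weighted_norm :: "real \<Rightarrow> (real \<Rightarrow> 'a::complex_hilbert_space) \<Rightarrow> real" where
  "L2_weighted_norm \<beta> f = sqrt (\<integral>t. (norm (f t))\<^sup>2 \<partial>weighted_half_line \<beta>)"

definition graph_norm :: "('a::complex_hilbert_space \<Rightarrow> 'a) \<Rightarrow> 'a \<Rightarrow> real" where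
  "graph_norm A x = sqrt ((norm x)\<^sup>2 + (norm (A x))\<^sup>2)"

definition L2_compact_support_domain ::
  "'a::complex_hilbert_space set \<Rightarrow> ('a \<Rightarrow> 'a) \<Rightarrow> (real \<Rightarrow> 'a) set" where
  "L2_compact_support_domain D A =
     {f \<in> L2_space (lebesgue_on {0<..}) D (graph_norm A).
        \<exists>K\<subseteq>{0<..}. compact K \<and> (AE t in lebesgue_on {0<..}. t \<notin> K \<longrightarrow> f t = 0)}"

section \<open>The maximal regularity operators\<close>

text \<open>The library's Bochner integral only covers second countable spaces.  The Henstock--Kurzweil
  integral used here is available in every Banach space, and it agrees with the Bochner integral
  for every Bochner integrable function; for \<open>f\<close> in \<open>L2_compact_support_domain D A\<close> the integrands
  are Bochner integrable.\<close>

definition M_plus ::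
  "('a::complex_hilbert_space \<Rightarrow> 'a) \<Rightarrow> (complex \<Rightarrow> 'a \<Rightarrow> 'a) \<Rightarrow> (real \<Rightarrow> 'a) \<Rightarrow> real \<Rightarrow> 'a" where
  "M_plus A S f t = integral {0..t} (\<lambda>s. A (S (complex_of_real (t - s)) (f s)))"

definition M_minus ::
  "('a::complex_hilbert_space \<Rightarrow> 'a) \<Rightarrow> (complex \<Rightarrow> 'a \<Rightarrow> 'a) \<Rightarrow> (real \<Rightarrow> 'a) \<Rightarrow> real \<Rightarrow> 'a" where
  "M_minus A S f t = integral {t..} (\<lambda>s. A (S (complex_of_real (s - t)) (f s)))"

definition bounded_operator_on_L2_weighted ::
  "real \<Rightarrow> ((real \<Rightarrow> 'a::complex_hilbert_space) \<Rightarrow> (real \<Rightarrow> 'a)) \<Rightarrow> bool" where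
  "bounded_operator_on_L2_weighted \<beta> T \<longleftrightarrow>
     (\<forall>f\<in>L2_weighted \<beta>. T f \<in> L2_weighted \<beta>) \<and>
     (\<forall>f\<in>L2_weighted \<beta>. \<forall>g\<in>L2_weighted \<beta>.
        AE t in weighted_half_line \<beta>. T (\<lambda>s. f s + g s) t = T f t + T g t) \<and>
     (\<forall>c. \<forall>f\<in>L2_weighted \<beta>.
        AE t in weighted_half_line \<beta>. T (\<lambda>s. c *\<^sub>C f s) t = c *\<^sub>C T f t) \<and>
     (\<exists>C. \<forall>f\<in>L2_weighted \<beta>. L2_weighted_norm \<beta> (T f) \<le> C * L2_weighted_norm \<beta> f)"

text \<open>An operator \<open>M\<close>, initially defined on \<open>L2_compact_support_domain D A\<close>, is bounded on the
  weighted space if it has a bounded extension.\<close>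

definition extends_to_bounded_operator ::
  "'a::complex_hilbert_space set \<Rightarrow> ('a \<Rightarrow> 'a) \<Rightarrow> real \<Rightarrow>
     ((real \<Rightarrow> 'a) \<Rightarrow> (real \<Rightarrow> 'a)) \<Rightarrow> bool" where
  "extends_to_bounded_operator D A \<beta> M \<longleftrightarrow>
     (\<exists>T. bounded_operator_on_L2_weighted \<beta> T \<and>
        (\<forall>f\<in>L2_compact_support_domain D A. AE t in weighted_half_line \<beta>. T f t = M f t))"

end

(* Take x in D with v = A x nonzero. By strong continuity, e^{-rA} v stays within |v|/2 of v for
   0 < r <= 2a. Applied to scalar functions on (0,oo) times x, the operators M+ and M- are
   therefore bounded below by |v|/2 times plain integration as long as t and s stay in (0,2a].
   For M+, the functions s^{-1} x on [p,a] have squared weighted norm O(ln (a/p)), as beta >= 1,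
   whereas |M+ f| is at least (|v|/2) ln (a/p) on (a,2a]; let p tend to 0. For M-, a single function
   suffices: x on [a,2a] is mapped to a function of norm at least a |v|/2 on (0,a), which is not
   square integrable with respect to t^{-beta} dt. *)
theory Submission
  imports Defs
begin

\<comment> \<open>Multiples of a fixed vector in L2 spaces, and integration on the weighted
  half-line\<close>
subclass (in complex_hilbert_space) banach ..

text \<open>Simple functions converging pointwise to \<open>g\<close>, multiplied by
  \<open>x\<close>, approximate \<open>g t *\<^sub>R x\<close> within \<open>V\<close>. Everything
  happens on the real line through \<open>x\<close>, so \<open>N\<close> has to be homogeneous only
  there; this lets one lemma serve both the Hilbert norm and the graph norm.\<close>

lemma scaleR_const_in_L2_space:
  fixes g :: "'b \<Rightarrow> real" and x :: "'a::real_vector"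
  assumes g: "g \<in> borel_measurable M" and int: "integrable M (\<lambda>t. (g t)\<^sup>2)"
    and V: "\<And>c. c *\<^sub>R x \<in> V" and N: "\<And>c. N (c *\<^sub>R x) = \<bar>c\<bar> * N x"
  shows "(\<lambda>t. g t *\<^sub>R x) \<in> L2_space M V N"
proof -
  obtain s where s: "\<And>n. simple_function M (s n)" 
    and lim: "\<And>t. t \<in> space M \<Longrightarrow> (\<lambda>n. s n t) \<longlonglongrightarrow> g t"
    using borel_measurable_implies_sequence_metric[OF g, of 0] by blast
  have "simple_function M (\<lambda>t. s n t *\<^sub>R x)" for n
    using simple_function_compose1[OF s] .
  moreover have "(\<lambda>n. N (s n t *\<^sub>R x - g t *\<^sub>R x)) \<longlonglongrightarrow> 0" if "t \<in> space M" for t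
  proof -
    have "(\<lambda>n. \<bar>s n t - g t\<bar> * N x) \<longlonglongrightarrow> 0"
      using lim[OF that] by (intro tendsto_mult_left_zero tendsto_rabs_zero) (simp add: LIM_zero)
    then show ?thesis by (simp add: N flip: scaleR_diff_left)
  qed
  ultimately have "strongly_measurable M V N (\<lambda>t. g t *\<^sub>R x)"
    unfolding strongly_measurable_def using V
    by (intro exI[of _ "\<lambda>n t. s n t *\<^sub>R x"]) auto
  moreover have "integrable M (\<lambda>t. (N (g t *\<^sub>R x))\<^sup>2)"
    using int by (simp add: N power_mult_distrib)
  ultimately show ?thesis by (simp add: L2_space_def)
qed

lemma
  fixes h :: "real \<Rightarrow> real"
  assumes "h \<in> borel_measurable (lebesgue_on {0<..})"
  shows integrable_weighted_half_line:
      "integrable (weighted_half_line \<beta>) h \<longleftrightarrow> 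
       integrable lebesgue (\<lambda>t. indicat_real {0<..} t * (t powr \<beta> * h t))" (is ?A)
    and integral_weighted_half_line:
      "integral\<^sup>L (weighted_half_line \<beta>) h =
       integral\<^sup>L lebesgue (\<lambda>t. indicat_real {0<..} t * (t powr \<beta> * h t))" (is ?B)
proof -
  have p: "(\<lambda>t::real. t powr \<beta>) \<in> borel_measurable (lebesgue_on {0<..})"
    by (intro measurable_restrict_space1 measurable_completion) auto
  show ?A
    unfolding weighted_half_line_def
    by (subst integrable_density[OF assms p]) (auto simp: integrable_restrict_space)
  show ?B
    unfolding weighted_half_line_def
    by (subst integral_density[OF assms p]) (auto simp: integral_restrict_space)
qed

text \<open>The density is strictly positive on the half-line for every real exponent, so weighting
  does not change the null sets.\<close>

lemma AE_weighted_half_line: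
  "(AE t in weighted_half_line \<beta>. P t) \<longleftrightarrow> (AE t in lebesgue. 0 < t \<longrightarrow> P t)"
proof -
  have p: "(\<lambda>t::real. ennreal (t powr \<beta>)) \<in> borel_measurable (lebesgue_on {0<..})"
    by (intro measurable_restrict_space1 measurable_completion) auto
  show ?thesis
    unfolding weighted_half_line_def
    by (subst AE_density[OF p], subst AE_restrict_space_iff) 
      (auto intro!: AE_cong)
qed

lemma borel_measurable_weighted_half_line:
  assumes "h \<in> borel_measurable (weighted_half_line \<beta>)"
  shows "h \<in> borel_measurable (lebesgue_on {0<..})"
  using assms by (simp add: weighted_half_line_def)

section \<open>Integrals of 1/t and lower bounds for vector-valued integrals\<close>

lemma has_bochner_integral_inverse_Icc:
  fixes p q :: real
  assumes "0 < p" "p \<le> q"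
  shows "has_bochner_integral lebesgue (\<lambda>t. indicat_real {p..q} t * (1 / t)) (ln (q / p))"
proof -
  have "has_bochner_integral lborel (\<lambda>t. (1 / t) * indicat_real {p..q} t) (ln q - ln p)"
    using assms
    by (intro has_bochner_integral_FTC_Icc_real)
      (auto intro!: derivative_eq_intros continuous_intros)
  then have "has_bochner_integral lebesgue (\<lambda>t. (1 / t) * indicat_real {p..q} t) (ln q - ln p)"
    by (auto simp: has_bochner_integral_iff integrable_completion integral_completion)
  with assms show ?thesis by (simp add: ln_div mult.commute)
qed

text \<open>The Henstock-Kurzweil counterpart of the previous lemma: \<open>M_plus\<close> is
  defined by this integral, whereas the weighted norms are Lebesgue integrals.\<close>

lemma has_integral_inverse_Icc:
  fixes p q :: real
  assumes "0 < p" "p \<le> q"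
  shows "((\<lambda>t. 1 / t) has_integral ln (q / p)) {p..q}"
proof -
  have "((\<lambda>t. 1 / t) has_integral (ln q - ln p)) {p..q}"
    using assms by (intro fundamental_theorem_of_calculus)
      (auto intro!: derivative_eq_intros simp: has_real_derivative_iff_has_vector_derivative[symmetric])
  with assms show ?thesis by (simp add: ln_div)
qed

lemma inner_ge_half_norm:
  fixes u v :: "'a::real_inner"
  assumes "norm (u - v) \<le> norm v / 2"
  shows "(norm v)\<^sup>2 / 2 \<le> inner u v"
proof -
  have "inner (v - u) v \<le> norm (u - v) * norm v"
    by (metis norm_cauchy_schwarz norm_minus_commute)
  also have "\<dots> \<le> norm v / 2 * norm v" using assms by (intro mult_right_mono) auto
  finally show ?thesis
    by (simp add: inner_diff_left power2_norm_eq_inner flip: power2_eq_square)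
qed

text \<open>Taking norms inside the integral would give only upper bounds. Pairing with
  \<open>v\<close> reduces the claim to a real integral, whose integrand is at least k |v|^2 / 2
  because \<open>F\<close> stays near \<open>v\<close>; Cauchy-Schwarz then costs one factor
  |v|.\<close>

lemma norm_integral_scaleR_ge:
  fixes F :: "real \<Rightarrow> 'a::{real_inner,banach}"
  assumes k: "continuous_on {p..q} k" "\<And>s. s \<in> {p..q} \<Longrightarrow> 0 \<le> k s"
    and F: "continuous_on {p..q} F" "\<And>s. s \<in> {p..q} \<Longrightarrow> norm (F s - v) \<le> norm v / 2"
  shows "norm v / 2 * integral {p..q} k \<le> norm (integral {p..q} (\<lambda>s. k s *\<^sub>R F s))"
proof (cases "v = 0")
  case False
  let ?I = "integral {p..q} (\<lambda>s. k s *\<^sub>R F s)"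
  have int: "(\<lambda>s. k s *\<^sub>R F s) integrable_on {p..q}"
    by (intro integrable_continuous_real continuous_intros k F)
  have "integral {p..q} k * ((norm v)\<^sup>2 / 2) = integral {p..q} (\<lambda>s. k s * ((norm v)\<^sup>2 / 2))"
    by simp
  also have "\<dots> \<le> integral {p..q} (\<lambda>s. inner (k s *\<^sub>R F s) v)"
    by (intro integral_le integrable_continuous_real continuous_intros k F)
      (metis inner_scaleR_left mult_left_mono inner_ge_half_norm k(2) F(2))
  also have "\<dots> = inner ?I v"
    using integral_linear[OF int bounded_linear_inner_left, of v] by (simp add: o_def)
  also have "\<dots> \<le> norm ?I * norm v" by (rule norm_cauchy_schwarz)
  finally show ?thesis using False by (simp add: power2_eq_square mult.commute)
qed simp

section \<open>The semigroup at positive real times and its generator\<close>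

lemma of_real_in_sector: "0 < r \<Longrightarrow> 0 < \<delta> \<Longrightarrow> complex_of_real r \<in> sector \<delta>"
  by (simp add: sector_def)

context
  fixes D :: "'a::complex_hilbert_space set" and A S
  assumes gen: "neg_generates_bounded_analytic_semigroup D A S"
begin

lemma clinear_on_domain: "clinear_on D A"
  using gen by (auto simp: neg_generates_bounded_analytic_semigroup_def densely_defined_closed_operator_def)

lemma
  assumes "x \<in> D"
  shows scaleR_domain: "c *\<^sub>R x \<in> D" and A_scaleR: "A (c *\<^sub>R x) = c *\<^sub>R A x"
  using clinear_on_domain assms unfolding clinear_on_def by (metis scaleC_of_real)+

lemma graph_norm_scaleR:
  assumes "x \<in> D"
  shows "graph_norm A (c *\<^sub>R x) = \<bar>c\<bar> * graph_norm A x"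
  by (simp add: graph_norm_def A_scaleR[OF assms] power_mult_distrib real_sqrt_mult flip: distrib_left)

lemma bounded_linear_semigroup:
  assumes "0 < r"
  shows "bounded_linear (S (complex_of_real r))"
proof -
  obtain \<delta> where \<delta>: "0 < \<delta>" "bounded_analytic_semigroup \<delta> S"
    using gen by (auto simp: neg_generates_bounded_analytic_semigroup_def)
  \<comment> \<open>Uniform bounds are available only on strictly smaller sectors; half the angle is
    enough, since every sector contains the positive half-line.\<close>
  obtain M where M: "\<forall>z\<in>sector (\<delta>/2). \<forall>x. norm (S z x) \<le> M * norm x"
    using \<delta> unfolding bounded_analytic_semigroup_def by (metis field_sum_of_halves half_gt_zero less_add_same_cancel1)
  have l: "clinear_on UNIV (S (complex_of_real r))"
    using \<delta> of_real_in_sector[OF assms] unfolding bounded_analytic_semigroup_def by blast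
  show ?thesis
  proof (rule bounded_linear_intro)
    show "S (complex_of_real r) (x + y) = S (complex_of_real r) x + S (complex_of_real r) y" for x y
      using l by (simp add: clinear_on_def)
    show "S (complex_of_real r) (c *\<^sub>R x) = c *\<^sub>R S (complex_of_real r) x" for c x
      using l unfolding clinear_on_def by (metis UNIV_I scaleC_of_real)
    show "norm (S (complex_of_real r) x) \<le> norm x * M" for x
      using M of_real_in_sector[OF assms, of "\<delta>/2"] \<delta> by (simp add: mult.commute)
  qed
qed

text \<open>S(r) commutes with the difference quotients at 0 and is continuous, so it carries their
  limit along. Since \<open>D\<close> consists of exactly the vectors whose quotients converge, S(r)
  x lies in \<open>D\<close>, and uniqueness of limits identifies the two values.\<close>

lemma A_semigroup_commute:
  assumes x: "x \<in> D" and r: "0 < r"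
  shows "A (S (complex_of_real r) x) = S (complex_of_real r) (A x)"
proof -
  interpret Sr: bounded_linear "S (complex_of_real r)"
    by (rule bounded_linear_semigroup[OF r])
  let ?q = "\<lambda>x t. (S (complex_of_real t) x - x) /\<^sub>R t"
  have q: "D = {x. \<exists>y. (?q x \<longlongrightarrow> y) (at_right 0)}" "\<forall>x\<in>D. (?q x \<longlongrightarrow> - A x) (at_right 0)"
    using gen by (auto simp: neg_generates_bounded_analytic_semigroup_def infinitesimal_generator_def)
  obtain \<delta> where \<delta>: "0 < \<delta>" "bounded_analytic_semigroup \<delta> S"
    using gen by (auto simp: neg_generates_bounded_analytic_semigroup_def)
  have comm: "S (complex_of_real t) (S (complex_of_real r) x) = S (complex_of_real r) (S (complex_of_real t) x)"
    if "0 < t" for t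
    using \<delta> of_real_in_sector[OF r \<delta>(1)] of_real_in_sector[OF that \<delta>(1)]
    unfolding bounded_analytic_semigroup_def by (metis add.commute)
  have "((\<lambda>t. S (complex_of_real r) (?q x t)) \<longlongrightarrow> S (complex_of_real r) (- A x)) (at_right 0)"
    using q x by (intro Sr.tendsto) auto
  moreover have "\<forall>\<^sub>F t in at_right 0. S (complex_of_real r) (?q x t) = ?q (S (complex_of_real r) x) t"
    using comm by (auto simp: eventually_at_filter Sr.scaleR Sr.diff)
  ultimately have lim: "(?q (S (complex_of_real r) x) \<longlongrightarrow> - S (complex_of_real r) (A x)) (at_right 0)"
    by (auto simp: linear_neg[OF Sr.linear] dest: Lim_transform_eventually)
  then have "S (complex_of_real r) x \<in> D" using q(1) by auto
  then have "(?q (S (complex_of_real r) x) \<longlongrightarrow> - A (S (complex_of_real r) x)) (at_right 0)"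
    using q(2) by auto
  with lim show ?thesis
    using tendsto_unique[OF trivial_limit_at_right_real] by fastforce
qed

text \<open>Complex differentiability on the sector yields continuity there. The sector omits 0,
  which is why \<open>g\<close> must stay positive.\<close>

lemma continuous_on_semigroup:
  assumes "continuous_on X g" "\<And>s. s \<in> X \<Longrightarrow> 0 < g s"
  shows "continuous_on X (\<lambda>s. S (complex_of_real (g s)) y)"
proof -
  obtain \<delta> where \<delta>: "0 < \<delta>" "bounded_analytic_semigroup \<delta> S"
    using gen by (auto simp: neg_generates_bounded_analytic_semigroup_def)
  have "continuous_on (sector \<delta>) (\<lambda>z. S z y)"
    using \<delta>(2) unfolding bounded_analytic_semigroup_def
    by (meson continuous_at_imp_continuous_on has_derivative_continuous)
  then show ?thesis
    by (rule continuous_on_compose2)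
      (use assms of_real_in_sector \<delta> in \<open>auto intro!: continuous_intros\<close>)
qed

text \<open>The bound 2 * a covers all time differences between points of (0,2a], the region in
  which both test functions and their images are examined.\<close>

lemma semigroup_near_initial_value:
  assumes "v \<noteq> 0"
  obtains a where "0 < a" "\<And>r. 0 < r \<Longrightarrow> r \<le> 2 * a \<Longrightarrow> norm (S (complex_of_real r) v - v) \<le> norm v / 2"
proof -
  obtain \<delta> where \<delta>: "0 < \<delta>" "bounded_analytic_semigroup \<delta> S"
    using gen by (auto simp: neg_generates_bounded_analytic_semigroup_def)
  have "((\<lambda>z. S z v) \<longlongrightarrow> v) (at 0 within sector (\<delta>/2))"
    using \<delta> unfolding bounded_analytic_semigroup_def by (metis field_sum_of_halves half_gt_zero less_add_same_cancel1)
  then obtain d where "d > 0" and d: "\<forall>z\<in>sector (\<delta>/2). 0 < dist z 0 \<and> dist z 0 < d \<longrightarrow> dist (S z v) v < norm v / 2"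
    using assms unfolding tendsto_iff eventually_at
    by (metis half_gt_zero zero_less_dist_iff zero_less_norm_iff)
  show ?thesis
  proof
    \<comment> \<open>Dividing by 3 rather than 2 keeps 2 * a strictly below d, as the strict
      inequality in the limit requires.\<close>
    show "0 < d / 3" using \<open>d > 0\<close> by simp
    show "norm (S (complex_of_real r) v - v) \<le> norm v / 2" if "0 < r" "r \<le> 2 * (d / 3)" for r
      using d of_real_in_sector[OF that(1), of "\<delta>/2"] \<delta>(1) that \<open>d > 0\<close>
      by (force simp: dist_norm)
  qed
qed

section \<open>Pointwise lower bounds for M+ and M- on test functions\<close>

lemma A_semigroup_cutoff:
  assumes x: "x \<in> D" and r: "0 \<le> r" "s \<in> X \<Longrightarrow> 0 < r"
  shows "A (S (complex_of_real r) ((indicat_real X s * k) *\<^sub>R x)) = 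
    (if s \<in> X then k *\<^sub>R S (complex_of_real r) (A x) else 0)"
proof -
  \<comment> \<open>Off \<open>X\<close> the vector is 0, but the time r may be 0 there, as at the
    endpoint s = t of the integrals. Linearity is known only at positive times, so time 0 is settled
    by S(0) being the identity.\<close>
  have "S 0 0 = 0"
    using gen by (auto simp: neg_generates_bounded_analytic_semigroup_def bounded_analytic_semigroup_def)
  then have "S (complex_of_real r) 0 = 0"
    using r linear_0[OF bounded_linear.linear[OF bounded_linear_semigroup[of r]]] by (cases "r = 0") auto
  moreover have "A 0 = 0"
    using A_scaleR[OF x, of 0] by simp
  moreover have "A (S (complex_of_real r) (k *\<^sub>R x)) = k *\<^sub>R S (complex_of_real r) (A x)" if "s \<in> X"
    using x r(2)[OF that] linear_scale[OF bounded_linear.linear[OF bounded_linear_semigroup]]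
    by (metis A_semigroup_commute A_scaleR scaleR_domain)
  ultimately show ?thesis by simp
qed

text \<open>For s in [p,a] and t in (a,2a] the time t - s lies in (0,2a), where \<open>near\<close>
  applies. As t lies beyond the support of the test function, the integral sees all of [p,a] and
  avoids time 0.\<close>

lemma norm_M_plus_ge:
  assumes x: "x \<in> D" and near: "\<And>r. 0 < r \<Longrightarrow> r \<le> 2 * a \<Longrightarrow> norm (S (complex_of_real r) (A x) - A x) \<le> norm (A x) / 2"
    and p: "0 < p" "p \<le> a" and t: "a < t" "t \<le> 2 * a"
  shows "norm (A x) / 2 * ln (a / p) \<le>
    norm (M_plus A S (\<lambda>s. (indicat_real {p..a} s * (1 / s)) *\<^sub>R x) t)"
proof -
  have "M_plus A S (\<lambda>s. (indicat_real {p..a} s * (1 / s)) *\<^sub>R x) t =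
      integral {0..t} (\<lambda>s. if s \<in> {p..a} then (1 / s) *\<^sub>R S (complex_of_real (t - s)) (A x) else 0)"
    unfolding M_plus_def
    by (intro integral_cong A_semigroup_cutoff[OF x]) (use p t in auto)
  also have "\<dots> = integral {p..a} (\<lambda>s. (1 / s) *\<^sub>R S (complex_of_real (t - s)) (A x))"
    by (subst integral_restrict_Int) (use p t in \<open>simp add: Int_absorb1\<close>)
  also have "norm \<dots> \<ge> norm (A x) / 2 * integral {p..a} (\<lambda>s. 1 / s)"
    by (intro norm_integral_scaleR_ge continuous_on_semigroup near)
      (use p t in \<open>auto intro!: continuous_intros\<close>)
  ultimately show ?thesis
    using integral_unique[OF has_integral_inverse_Icc[OF p]] by simp
qed

text \<open>Here s lies in [a,2a] and t in (0,a), so again s - t lies in (0,2a); the factor a is the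
  length of the support.\<close>

lemma norm_M_minus_ge:
  assumes x: "x \<in> D" and near: "\<And>r. 0 < r \<Longrightarrow> r \<le> 2 * a \<Longrightarrow> norm (S (complex_of_real r) (A x) - A x) \<le> norm (A x) / 2"
    and t: "0 < t" "t < a"
  shows "norm (A x) / 2 * a \<le> norm (M_minus A S (\<lambda>s. indicat_real {a..2 * a} s *\<^sub>R x) t)"
proof -
  have "M_minus A S (\<lambda>s. indicat_real {a..2 * a} s *\<^sub>R x) t =
      integral {t..} (\<lambda>s. if s \<in> {a..2 * a} then 1 *\<^sub>R S (complex_of_real (s - t)) (A x) else 0)"
    unfolding M_minus_def
    by (intro integral_cong A_semigroup_cutoff[OF x, where k = 1, unfolded mult_1_right])
      (use t in auto)
  also have "\<dots> = integral {a..2 * a} (\<lambda>s. 1 *\<^sub>R S (complex_of_real (s - t)) (A x))"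
    by (subst integral_restrict_Int) (use t in \<open>simp add: Int_absorb1\<close>)
  also have "norm \<dots> \<ge> norm (A x) / 2 * integral {a..2 * a} (\<lambda>s. 1)"
    by (intro norm_integral_scaleR_ge continuous_on_semigroup near)
      (use t in \<open>auto intro!: continuous_intros\<close>)
  ultimately show ?thesis
    using t by simp
qed

section \<open>Membership of the test functions and lower bounds for weighted norms\<close>

lemma cutoff_in_L2_compact_support_domain:
  fixes p q :: real
  assumes x: "x \<in> D" and p: "0 < p" and k: "continuous_on {p..q} k"
  shows "(\<lambda>s. (indicat_real {p..q} s * k s) *\<^sub>R x) \<in> L2_compact_support_domain D A"
proof -
  let ?g = "\<lambda>s. indicat_real {p..q} s * k s"
  have "set_integrable lborel {p..q} (\<lambda>s. (k s)\<^sup>2)"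
    by (intro borel_integrable_atLeastAtMost' continuous_intros k)
  moreover have "set_borel_measurable borel {p..q} k"
    unfolding set_borel_measurable_def
    using k by (intro borel_measurable_continuous_on_indicator) auto
  moreover have sq: "(indicat_real {p..q} s)\<^sup>2 = indicat_real {p..q} s" for s
    by (simp add: indicator_def)
  ultimately have "?g \<in> borel_measurable lebesgue" "integrable lebesgue (\<lambda>s. (?g s)\<^sup>2)"
    by (auto simp: set_integrable_def set_borel_measurable_def integrable_completion power_mult_distrib sq
        intro!: measurable_completion)
  moreover have "(\<lambda>s. indicat_real {0<..} s * (?g s)\<^sup>2) = (\<lambda>s. (?g s)\<^sup>2)"
    using p by (auto simp: indicator_def)
  ultimately have "(\<lambda>s. ?g s *\<^sub>R x) \<in> L2_space (lebesgue_on {0<..}) D (graph_norm A)"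
    using x by (intro scaleR_const_in_L2_space)
      (auto simp: scaleR_domain graph_norm_scaleR integrable_restrict_space intro: measurable_restrict_space1)
  moreover have "\<exists>K\<subseteq>{0<..}. compact K \<and> (AE t in lebesgue_on {0<..}. t \<notin> K \<longrightarrow> ?g t *\<^sub>R x = 0)"
    using p by (intro exI[of _ "{p..q}"]) auto
  ultimately show ?thesis by (simp add: L2_compact_support_domain_def)
qed

end

lemma cutoff_in_L2_weighted:
  fixes p q :: real and x :: "'a::complex_hilbert_space"
  assumes p: "0 < p" and k: "continuous_on {p..q} k"
  shows "(\<lambda>s. (indicat_real {p..q} s * k s) *\<^sub>R x) \<in> L2_weighted \<beta>" (is ?A)
    and "integral\<^sup>L (weighted_half_line \<beta>) (\<lambda>s. (norm ((indicat_real {p..q} s * k s) *\<^sub>R x))\<^sup>2) =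
      (norm x)\<^sup>2 * integral\<^sup>L lebesgue (\<lambda>s. indicat_real {p..q} s * (s powr \<beta> * (k s)\<^sup>2))" (is ?B)
proof -
  let ?g = "\<lambda>s. indicat_real {p..q} s * k s"
  have "set_integrable lborel {p..q} (\<lambda>s. s powr \<beta> * (k s)\<^sup>2)"
    using p by (intro borel_integrable_atLeastAtMost' continuous_intros k) auto
  then have int: "integrable lebesgue (\<lambda>s. indicat_real {p..q} s * (s powr \<beta> * (k s)\<^sup>2))"
    by (auto simp: set_integrable_def integrable_completion)
  have "set_borel_measurable borel {p..q} k"
    unfolding set_borel_measurable_def
    using k by (intro borel_measurable_continuous_on_indicator) auto
  then have meas: "?g \<in> borel_measurable (lebesgue_on {0<..})"
    by (auto simp: set_borel_measurable_def intro!: measurable_completion measurable_restrict_space1)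
  have eq: "indicat_real {0<..} s * (s powr \<beta> * (?g s)\<^sup>2) = indicat_real {p..q} s * (s powr \<beta> * (k s)\<^sup>2)" for s
    using p by (auto simp: indicator_def)
  have "integrable (weighted_half_line \<beta>) (\<lambda>s. (?g s)\<^sup>2)"
    using int meas by (subst integrable_weighted_half_line) (auto simp: eq)
  with meas show ?A
    by (intro scaleR_const_in_L2_space) (auto simp: weighted_half_line_def)
  have "integral\<^sup>L (weighted_half_line \<beta>) (\<lambda>s. (?g s)\<^sup>2) = 
      integral\<^sup>L lebesgue (\<lambda>s. indicat_real {p..q} s * (s powr \<beta> * (k s)\<^sup>2))"
    using meas by (subst integral_weighted_half_line) (auto simp: eq)
  then show ?B
    by (simp add: power_mult_distrib)
qed

text \<open>An integrable minorant \<open>b\<close> of the weighted square bounds the norm from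
  below. Membership of \<open>F\<close> supplies the integrability of that square; without it the
  integral in the norm would take the default value 0. Integrals run over the whole line, hence the
  sign condition on \<open>b\<close> for t <= 0.\<close>

lemma L2_weighted_lower_bound:
  fixes F :: "real \<Rightarrow> 'a::complex_hilbert_space"
  assumes F: "F \<in> L2_weighted \<beta>"
    and b: "has_bochner_integral lebesgue b B"
    and le: "AE t in lebesgue. 0 < t \<longrightarrow> b t \<le> t powr \<beta> * (norm (F t))\<^sup>2"
    and neg: "AE t in lebesgue. t \<le> 0 \<longrightarrow> b t \<le> 0"
  shows "B \<le> (L2_weighted_norm \<beta> F)\<^sup>2"
proof -
  have int: "integrable (weighted_half_line \<beta>) (\<lambda>t. (norm (F t))\<^sup>2)"
    using F by (simp add: L2_space_def)
  note meas = borel_measurable_weighted_half_line[OF borel_measurable_integrable[OF int]]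
  have "B = integral\<^sup>L lebesgue b"
    using b by (simp add: has_bochner_integral_iff)
  also have "\<dots> \<le> integral\<^sup>L lebesgue (\<lambda>t. indicat_real {0<..} t * (t powr \<beta> * (norm (F t))\<^sup>2))"
  proof (rule integral_mono_AE)
    show "integrable lebesgue b" using b by (simp add: has_bochner_integral_iff)
    show "integrable lebesgue (\<lambda>t. indicat_real {0<..} t * (t powr \<beta> * (norm (F t))\<^sup>2))"
      using int integrable_weighted_half_line[OF meas] by simp
    show "AE t in lebesgue. b t \<le> indicat_real {0<..} t * (t powr \<beta> * (norm (F t))\<^sup>2)"
      using le neg by eventually_elim (auto simp: indicator_def)
  qed
  also have "\<dots> = (L2_weighted_norm \<beta> F)\<^sup>2"
    by (simp add: L2_weighted_norm_def flip: integral_weighted_half_line[OF meas])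
  finally show ?thesis .
qed

theorem theorem1p5:
  fixes D :: "'a::complex_hilbert_space set"
    and A :: "'a \<Rightarrow> 'a"
    and S :: "complex \<Rightarrow> 'a \<Rightarrow> 'a"
    and \<beta> :: real
  assumes "neg_generates_bounded_analytic_semigroup D A S"
    and "\<exists>x\<in>D. A x \<noteq> 0"
    and "\<beta> \<ge> 1"
  shows "\<not> extends_to_bounded_operator D A \<beta> (M_plus A S) \<and>
         \<not> extends_to_bounded_operator D A (- \<beta>) (M_minus A S)"
proof -
  note gen = assms(1)
  obtain x where x: "x \<in> D" "A x \<noteq> 0" using assms(2) by blast
  obtain a where a: "0 < a"
    and near: "\<And>r. 0 < r \<Longrightarrow> r \<le> 2 * a \<Longrightarrow> norm (S (complex_of_real r) (A x) - A x) \<le> norm (A x) / 2"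
    using semigroup_near_initial_value[OF gen x(2)] by blast
  have "\<not> extends_to_bounded_operator D A \<beta> (M_plus A S)"
  proof
    assume "extends_to_bounded_operator D A \<beta> (M_plus A S)"
    then obtain T where T: "bounded_operator_on_L2_weighted \<beta> T"
      and ext: "\<forall>f\<in>L2_compact_support_domain D A. AE t in weighted_half_line \<beta>. T f t = M_plus A S f t"
      by (auto simp: extends_to_bounded_operator_def)
    then obtain C where C: "\<forall>f\<in>L2_weighted \<beta>. L2_weighted_norm \<beta> (T f) \<le> C * L2_weighted_norm \<beta> f"
      by (auto simp: bounded_operator_on_L2_weighted_def)
    \<comment> \<open>In \<open>K\<close> the pointwise bound on M+ f is squared without its factor
      L = ln (a/p); the weight on (a,2a] is at least a^beta, and the interval has length a.
      \<open>K'\<close> collects the operator bound and the estimate of the squared norm of f, again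
      without L.\<close>
    define K where "K = (norm (A x) / 2)\<^sup>2 * a powr \<beta> * a"
    define K' where "K' = C\<^sup>2 * ((norm x)\<^sup>2 * a powr (\<beta> - 1))"
    have "K > 0" using a x by (simp add: K_def)
    \<comment> \<open>The image grows quadratically in L and the squared norm of the test function
      only linearly.\<close>
    have bound: "K * L\<^sup>2 \<le> K' * L" if L: "0 < L" for L
    proof -
      \<comment> \<open>Chosen so that ln (a/p) is exactly L.\<close>
      define p where "p = a / exp L"
      have p: "0 < p" "p \<le> a" "ln (a / p) = L"
        using a L by (auto simp: p_def divide_le_eq)
      let ?f = "\<lambda>s. (indicat_real {p..a} s * (1 / s)) *\<^sub>R x"
      have k: "continuous_on {p..a} (\<lambda>s. 1 / s)"
        using p by (auto intro!: continuous_intros)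
      note f = cutoff_in_L2_weighted[OF p(1) k, where x = x and \<beta> = \<beta>]
      have eq: "AE t in lebesgue. 0 < t \<longrightarrow> T ?f t = M_plus A S ?f t"
        using ext cutoff_in_L2_compact_support_domain[OF gen x(1) p(1) k]
        by (simp add: AE_weighted_half_line)
      have low: "(norm (A x) / 2 * L)\<^sup>2 * a powr \<beta> \<le> t powr \<beta> * (norm (M_plus A S ?f t))\<^sup>2"
        if "a < t" "t \<le> 2 * a" for t
        using norm_M_plus_ge[OF gen x(1) near p(1,2) that] p that a assms(3) L
        by (subst mult.commute) (auto intro!: mult_mono power_mono powr_mono2)
      have le: "AE t in lebesgue. 0 < t \<longrightarrow> 
          ((norm (A x) / 2 * L)\<^sup>2 * a powr \<beta>) * indicat_real {a<..2 * a} t \<le> t powr \<beta> * (norm (T ?f t))\<^sup>2"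
        using eq by eventually_elim (use low in \<open>auto split: split_indicator\<close>)
      have "has_bochner_integral lebesgue (indicat_real {a<..2 * a}) (measure lebesgue {a<..2 * a})"
        by (rule has_bochner_integral_real_indicator) (use a in auto)
      then have ind: "has_bochner_integral lebesgue (indicat_real {a<..2 * a}) a"
        using a by simp
      have "K * L\<^sup>2 = (norm (A x) / 2 * L)\<^sup>2 * a powr \<beta> * a"
        by (simp add: K_def power2_eq_square mult_ac)
      also have "\<dots> \<le> (L2_weighted_norm \<beta> (T ?f))\<^sup>2"
      proof (rule L2_weighted_lower_bound[OF _ has_bochner_integral_mult_right[OF ind] le])
        show "T ?f \<in> L2_weighted \<beta>"
          using T f(1) by (simp add: bounded_operator_on_L2_weighted_def)
      qed (use a in auto)
      also have "\<dots> \<le> (C * L2_weighted_norm \<beta> ?f)\<^sup>2"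
        using C f(1) by (intro power_mono) (auto simp: L2_weighted_norm_def)
      also have "\<dots> = C\<^sup>2 * ((norm x)\<^sup>2 * 
          integral\<^sup>L lebesgue (\<lambda>s. indicat_real {p..a} s * (s powr \<beta> * (1 / s)\<^sup>2)))"
        unfolding f(2)[symmetric] by (simp add: L2_weighted_norm_def power_mult_distrib)
      also have "integral\<^sup>L lebesgue (\<lambda>s. indicat_real {p..a} s * (s powr \<beta> * (1 / s)\<^sup>2)) \<le> 
          a powr (\<beta> - 1) * L"
      proof -
        have inv: "has_bochner_integral lebesgue (\<lambda>t. a powr (\<beta> - 1) * (indicat_real {p..a} t * (1 / t)))
            (a powr (\<beta> - 1) * L)"
          using has_bochner_integral_mult_right[OF has_bochner_integral_inverse_Icc[OF p(1,2)]] p(3) by metis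
        \<comment> \<open>This is where beta >= 1 enters: s^(beta-1) is then nondecreasing, so
          a^(beta-1) bounds it on [p,a] uniformly in p.\<close>
        have "s powr \<beta> * (1 / s)\<^sup>2 \<le> a powr (\<beta> - 1) * (1 / s)" if "p \<le> s" "s \<le> a" for s
        proof -
          have "s powr \<beta> * (1 / s)\<^sup>2 = s powr (\<beta> - 1) * (1 / s)"
            using that p by (simp add: powr_diff power2_eq_square)
          also have "\<dots> \<le> a powr (\<beta> - 1) * (1 / s)"
            using that p assms(3) by (intro mult_right_mono powr_mono2) auto
          finally show ?thesis .
        qed
        then have "integral\<^sup>L lebesgue (\<lambda>s. indicat_real {p..a} s * (s powr \<beta> * (1 / s)\<^sup>2)) \<le> 
            integral\<^sup>L lebesgue (\<lambda>t. a powr (\<beta> - 1) * (indicat_real {p..a} t * (1 / t)))"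
          using inv p(1) by (intro integral_mono_AE') (auto simp: has_bochner_integral_iff indicator_def)
        with inv show ?thesis by (simp add: has_bochner_integral_iff)
      qed
      then have "C\<^sup>2 * ((norm x)\<^sup>2 * 
          integral\<^sup>L lebesgue (\<lambda>s. indicat_real {p..a} s * (s powr \<beta> * (1 / s)\<^sup>2))) \<le> K' * L"
        unfolding K'_def mult.assoc by (intro mult_left_mono) auto
      finally show ?thesis .
    qed
    have "K * L \<le> K'" if "0 < L" for L
      using bound[OF that] that by (simp add: power2_eq_square)
    \<comment> \<open>For this L the left side K * L equals |K'| + K, which exceeds K'.\<close>
    from this[of "\<bar>K'\<bar> / K + 1"] show False
      using \<open>K > 0\<close> by (simp add: distrib_left add_nonneg_pos)
  qed
  moreover have "\<not> extends_to_bounded_operator D A (- \<beta>) (M_minus A S)"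
  proof
    assume "extends_to_bounded_operator D A (- \<beta>) (M_minus A S)"
    then obtain T where T: "bounded_operator_on_L2_weighted (- \<beta>) T"
      and ext: "\<forall>f\<in>L2_compact_support_domain D A. AE t in weighted_half_line (- \<beta>). T f t = M_minus A S f t"
      by (auto simp: extends_to_bounded_operator_def)
    let ?f = "\<lambda>s. indicat_real {a..2 * a} s *\<^sub>R x"
    have "?f \<in> L2_weighted (- \<beta>)"
      using cutoff_in_L2_weighted(1)[OF a, of "2 * a" "\<lambda>_. 1" x "- \<beta>"] by simp
    then have Tf: "T ?f \<in> L2_weighted (- \<beta>)"
      using T by (simp add: bounded_operator_on_L2_weighted_def)
    have "?f \<in> L2_compact_support_domain D A"
      using cutoff_in_L2_compact_support_domain[OF gen x(1) a, of "2 * a" "\<lambda>_. 1"] by simp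
    then have eq: "AE t in lebesgue. 0 < t \<longrightarrow> T ?f t = M_minus A S ?f t"
      using ext by (simp add: AE_weighted_half_line)
    \<comment> \<open>For t < a and beta >= 1, t^(-beta) = t^(1-beta) / t >= a^(1-beta) / t. With
      the squared lower bound on M- f, the weighted square is at least K / t.\<close>
    define K where "K = (norm (A x) / 2 * a)\<^sup>2 * a powr (1 - \<beta>)"
    have "K > 0" using a x by (simp add: K_def)
    \<comment> \<open>K / t is not integrable on (0,a), so it is truncated to [p,a], where its
      integral is K * L. Membership of \<open>T ?f\<close> in the weighted space makes its norm a
      finite number, yet L is arbitrary.\<close>
    have bound: "K * L \<le> (L2_weighted_norm (- \<beta>) (T ?f))\<^sup>2" if L: "0 < L" for L
    proof (rule L2_weighted_lower_bound[OF Tf])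
      define p where "p = a / exp L"
      have p: "0 < p" "p \<le> a" "ln (a / p) = L"
        using a L by (auto simp: p_def divide_le_eq)
      show "has_bochner_integral lebesgue (\<lambda>t. K * (indicat_real {p..a} t * (1 / t))) (K * L)"
        using has_bochner_integral_mult_right[OF has_bochner_integral_inverse_Icc[OF p(1,2)]] p(3) by metis
      have low: "K * (1 / t) \<le> t powr (- \<beta>) * (norm (M_minus A S ?f t))\<^sup>2" if "p \<le> t" "t < a" for t
      proof -
        have "K * (1 / t) = (a powr (1 - \<beta>) * (1 / t)) * (norm (A x) / 2 * a)\<^sup>2"
          by (simp add: K_def)
        also have "\<dots> \<le> (t powr (1 - \<beta>) * (1 / t)) * (norm (M_minus A S ?f t))\<^sup>2"
          using that p a assms(3) norm_M_minus_ge[OF gen x(1) near, where t = t]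
          by (intro mult_mono power_mono powr_mono2') auto
        also have "t powr (1 - \<beta>) * (1 / t) = t powr (- \<beta>)"
          using that p by (simp add: powr_diff powr_minus divide_simps)
        finally show ?thesis .
      qed
      \<comment> \<open>The minorant lives on the closed interval [p,a], while \<open>low\<close>
        requires t < a; the endpoint is a null set.\<close>
      have "AE t in lebesgue. t \<noteq> a"
        by (intro AE_completion AE_lborel_singleton)
      then show "AE t in lebesgue. 0 < t \<longrightarrow>
          K * (indicat_real {p..a} t * (1 / t)) \<le> t powr (- \<beta>) * (norm (T ?f t))\<^sup>2"
        using eq by eventually_elim (use low in \<open>auto simp: less_le split: split_indicator\<close>)
      show "AE t in lebesgue. t \<le> 0 \<longrightarrow> K * (indicat_real {p..a} t * (1 / t)) \<le> 0"
        using p(1) by (auto simp: indicator_def)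
    qed
    let ?N = "(L2_weighted_norm (- \<beta>) (T ?f))\<^sup>2"
    \<comment> \<open>With L = ?N / K + 1 the left side equals ?N + K.\<close>
    have "K * (?N / K + 1) \<le> ?N"
      using \<open>K > 0\<close> by (intro bound) (auto intro: add_nonneg_pos)
    then show False
      using \<open>K > 0\<close> by (simp add: distrib_left)
  qed
  ultimately show ?thesis ..
qed

end
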